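(* Let $(\mathcal{C},\mathcal{W})$ be a split-generated category with weak equivalences. The congruences $\sim_\ell$, $\sim_r$ and $\sim_{\mathcal{W}}$ in $\mathcal{C}$ all coincide.
   Context: A category with weak equivalences is a pair $(\mathcal{C},\mathcal{W})$ where $\mathcal{W}$ is a family of arrows of the category $\mathcal{C}$ (the weak equivalences) containing all identities and having the two out of three property: for composable $f,g$, if two of $f,g,gf$ are in $\mathcal{W}$ then so is the third. An arrow splits if it is a section (has a left inverse) or a retraction (has a right inverse). $(\mathcal{C},\mathcal{W})$ is split-generated if every arrow of $\mathcal{W}$ is a (finite) composition of weak equivalences that split. A congruence in $\mathcal{C}$ is a choice of an equivalence relation on each hom-set $\mathcal{C}(A,B)$ such that $f\sim g$ implies $vfu\sim vgu$ whenever the compositions make sense. For parallel arrows $f,g:A\to B$: $f\,R_\ell\,g$ if and only if there exists a weak equivalence $\sigma:B\to C$ with $\sigma f=\sigma g$; $f\,R_r\,g$ if and only if there exists a weak equivalence $s:C\to A$ with $fs=gs$. $\sim_\ell$ (resp. $\sim_r$) is the least congruence containing $R_\ell$ (resp. $R_r$). Let $\gamma:\mathcal{C}\to Ho(\mathcal{C})$ be the localization of $\mathcal{C}$ with respect to $\mathcal{W}$ (the universal functor sending arrows of $\mathcal{W}$ to isomorphisms; size issues are ignored). The homotopy relation $\sim_{\mathcal{W}}$ relates parallel arrows $f,g$ if and only if $\gamma f=\gamma g$. *)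

theory Defs
  imports Main
begin

section \<open>Categories and functors\<close>

record ('o, 'a) cat =
  Obj :: "'o set"
  Arr :: "'a set"
  Dom :: "'a \<Rightarrow> 'o"
  Cod :: "'a \<Rightarrow> 'o"
  Idt :: "'o \<Rightarrow> 'a"
  Cmp :: "'a \<Rightarrow> 'a \<Rightarrow> 'a"  (infixr "\<cdot>\<index>" 70)

text \<open>\<open>g \<cdot> f\<close> is "first \<open>f\<close>, then \<open>g\<close>"; it is only meaningful when \<open>Cod f = Dom g\<close>.\<close>

locale category =
  fixes C :: "('o, 'a) cat" (structure)
  assumes dom_obj: "f \<in> Arr C \<Longrightarrow> Dom C f \<in> Obj C"
    and cod_obj: "f \<in> Arr C \<Longrightarrow> Cod C f \<in> Obj C"
    and idt_arr: "A \<in> Obj C \<Longrightarrow> Idt C A \<in> Arr C"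
    and dom_idt: "A \<in> Obj C \<Longrightarrow> Dom C (Idt C A) = A"
    and cod_idt: "A \<in> Obj C \<Longrightarrow> Cod C (Idt C A) = A"
    and cmp_arr: "\<lbrakk>f \<in> Arr C; g \<in> Arr C; Cod C f = Dom C g\<rbrakk> \<Longrightarrow> g \<cdot> f \<in> Arr C"
    and dom_cmp: "\<lbrakk>f \<in> Arr C; g \<in> Arr C; Cod C f = Dom C g\<rbrakk> \<Longrightarrow> Dom C (g \<cdot> f) = Dom C f"
    and cod_cmp: "\<lbrakk>f \<in> Arr C; g \<in> Arr C; Cod C f = Dom C g\<rbrakk> \<Longrightarrow> Cod C (g \<cdot> f) = Cod C g"
    and cmp_idt: "f \<in> Arr C \<Longrightarrow> f \<cdot> Idt C (Dom C f) = f"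
    and idt_cmp: "f \<in> Arr C \<Longrightarrow> Idt C (Cod C f) \<cdot> f = f"
    and cmp_assoc: "\<lbrakk>f \<in> Arr C; g \<in> Arr C; h \<in> Arr C; Cod C f = Dom C g; Cod C g = Dom C h\<rbrakk>
      \<Longrightarrow> (h \<cdot> g) \<cdot> f = h \<cdot> (g \<cdot> f)"

definition parallel :: "('o, 'a) cat \<Rightarrow> 'a \<Rightarrow> 'a \<Rightarrow> bool" where
  "parallel C f g \<longleftrightarrow> f \<in> Arr C \<and> g \<in> Arr C \<and> Dom C f = Dom C g \<and> Cod C f = Cod C g"

definition inverse_arrows :: "('o, 'a) cat \<Rightarrow> 'a \<Rightarrow> 'a \<Rightarrow> bool" where
  "inverse_arrows C f g \<longleftrightarrow> f \<in> Arr C \<and> g \<in> Arr C \<and> Dom C g = Cod C f \<and> Cod C g = Dom C f \<and>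
     g \<cdot>\<^bsub>C\<^esub> f = Idt C (Dom C f) \<and> f \<cdot>\<^bsub>C\<^esub> g = Idt C (Cod C f)"

definition is_iso :: "('o, 'a) cat \<Rightarrow> 'a \<Rightarrow> bool" where
  "is_iso C f \<longleftrightarrow> (\<exists>g. inverse_arrows C f g)"

definition is_section :: "('o, 'a) cat \<Rightarrow> 'a \<Rightarrow> bool" where
  "is_section C f \<longleftrightarrow> f \<in> Arr C \<and>
     (\<exists>r\<in>Arr C. Dom C r = Cod C f \<and> Cod C r = Dom C f \<and> r \<cdot>\<^bsub>C\<^esub> f = Idt C (Dom C f))"

definition is_retraction :: "('o, 'a) cat \<Rightarrow> 'a \<Rightarrow> bool" where
  "is_retraction C f \<longleftrightarrow> f \<in> Arr C \<and>
     (\<exists>s\<in>Arr C. Dom C s = Cod C f \<and> Cod C s = Dom C f \<and> f \<cdot>\<^bsub>C\<^esub> s = Idt C (Cod C f))"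

definition splits :: "('o, 'a) cat \<Rightarrow> 'a \<Rightarrow> bool" where
  "splits C f \<longleftrightarrow> is_section C f \<or> is_retraction C f"

definition is_functor ::
    "('o, 'a) cat \<Rightarrow> ('p, 'b) cat \<Rightarrow> ('o \<Rightarrow> 'p) \<Rightarrow> ('a \<Rightarrow> 'b) \<Rightarrow> bool" where
  "is_functor C D Fo Fa \<longleftrightarrow>
     (\<forall>A\<in>Obj C. Fo A \<in> Obj D \<and> Fa (Idt C A) = Idt D (Fo A)) \<and>
     (\<forall>f\<in>Arr C. Fa f \<in> Arr D \<and> Dom D (Fa f) = Fo (Dom C f) \<and> Cod D (Fa f) = Fo (Cod C f)) \<and>
     (\<forall>f\<in>Arr C. \<forall>g\<in>Arr C. Cod C f = Dom C g \<longrightarrow> Fa (g \<cdot>\<^bsub>C\<^esub> f) = Fa g \<cdot>\<^bsub>D\<^esub> Fa f)"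


section \<open>Weak equivalences\<close>

locale category_with_weak_equivalences = category C
  for C :: "('o, 'a) cat" (structure) +
  fixes W :: "'a set"
  assumes weq_arr: "W \<subseteq> Arr C"
    and weq_idt: "A \<in> Obj C \<Longrightarrow> Idt C A \<in> W"
    and weq_cmp: "\<lbrakk>f \<in> Arr C; g \<in> Arr C; Cod C f = Dom C g; f \<in> W; g \<in> W\<rbrakk> \<Longrightarrow> g \<cdot> f \<in> W"
    and weq_cancel_left:
      "\<lbrakk>f \<in> Arr C; g \<in> Arr C; Cod C f = Dom C g; g \<in> W; g \<cdot> f \<in> W\<rbrakk> \<Longrightarrow> f \<in> W"
    and weq_cancel_right:
      "\<lbrakk>f \<in> Arr C; g \<in> Arr C; Cod C f = Dom C g; f \<in> W; g \<cdot> f \<in> W\<rbrakk> \<Longrightarrow> g \<in> W"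

text \<open>Identities split and are weak equivalences, so empty composites need no separate clause.\<close>

inductive_set split_composites :: "('o, 'a) cat \<Rightarrow> 'a set \<Rightarrow> 'a set"
  for C :: "('o, 'a) cat" and W :: "'a set" where
  single: "\<lbrakk>w \<in> W; splits C w\<rbrakk> \<Longrightarrow> w \<in> split_composites C W"
| comp: "\<lbrakk>v \<in> split_composites C W; w \<in> W; splits C w; Cod C v = Dom C w\<rbrakk>
    \<Longrightarrow> w \<cdot>\<^bsub>C\<^esub> v \<in> split_composites C W"

locale split_generated = category_with_weak_equivalences C W
  for C :: "('o, 'a) cat" (structure) and W :: "'a set" +
  assumes weq_split: "W \<subseteq> split_composites C W"


section \<open>Congruences\<close>

text \<open>An equivalence relation on each hom-set is encoded as one equivalence relation on the set
  of all arrows which relates only parallel arrows.\<close>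

definition congruence :: "('o, 'a) cat \<Rightarrow> 'a rel \<Rightarrow> bool" where
  "congruence C R \<longleftrightarrow>
     equiv (Arr C) R \<and>
     (\<forall>(f, g)\<in>R. parallel C f g) \<and>
     (\<forall>(f, g)\<in>R. \<forall>u\<in>Arr C. \<forall>v\<in>Arr C. Cod C u = Dom C f \<longrightarrow> Cod C f = Dom C v \<longrightarrow>
        (v \<cdot>\<^bsub>C\<^esub> f \<cdot>\<^bsub>C\<^esub> u, v \<cdot>\<^bsub>C\<^esub> g \<cdot>\<^bsub>C\<^esub> u) \<in> R)"

definition congruence_closure :: "('o, 'a) cat \<Rightarrow> 'a rel \<Rightarrow> 'a rel" where
  "congruence_closure C S = \<Inter> {R. congruence C R \<and> S \<subseteq> R}"

lemma congruence_closure_least: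
  "\<lbrakk>congruence C R; S \<subseteq> R\<rbrakk> \<Longrightarrow> congruence_closure C S \<subseteq> R"
  unfolding congruence_closure_def by blast

lemma (in category) congruence_congruence_closure:
  assumes S: "\<And>f g. (f, g) \<in> S \<Longrightarrow> parallel C f g"
  shows "congruence C (congruence_closure C S)" and "S \<subseteq> congruence_closure C S"
proof -
  let ?P = "{(f, g). parallel C f g}"
  have "congruence C ?P"
    unfolding congruence_def equiv_def refl_on_def sym_def trans_def parallel_def
    by (auto simp: cmp_arr dom_cmp cod_cmp)
  then have P: "congruence C ?P \<and> S \<subseteq> ?P" using S by auto
  show "S \<subseteq> congruence_closure C S" by (auto simp: congruence_closure_def)
  have mem: "(f, g) \<in> congruence_closure C S \<longleftrightarrow> (\<forall>R. congruence C R \<longrightarrow> S \<subseteq> R \<longrightarrow> (f, g) \<in> R)"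
    for f g by (auto simp: congruence_closure_def)
  have par: "parallel C f g" if "(f, g) \<in> congruence_closure C S" for f g
    using that P unfolding mem by auto
  have "equiv (Arr C) (congruence_closure C S)"
  proof (rule equivI)
    show "congruence_closure C S \<subseteq> Arr C \<times> Arr C"
      using par by (auto simp: parallel_def)
    show "refl_on (Arr C) (congruence_closure C S)"
      unfolding refl_on_def mem by (auto simp: congruence_def equiv_def refl_on_def)
    show "sym (congruence_closure C S)"
      unfolding sym_def mem by (meson congruence_def equiv_def symD)
    show "trans (congruence_closure C S)"
      unfolding trans_def mem by (meson congruence_def equiv_def transD)
  qed
  moreover have "(v \<cdot> f \<cdot> u, v \<cdot> g \<cdot> u) \<in> congruence_closure C S"
    if fg: "(f, g) \<in> congruence_closure C S" and uv: "u \<in> Arr C" "v \<in> Arr C"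
      "Cod C u = Dom C f" "Cod C f = Dom C v" for f g u v
    unfolding mem
  proof (intro allI impI)
    fix R assume R: "congruence C R" "S \<subseteq> R"
    then have "(f, g) \<in> R" using fg unfolding mem by blast
    with R(1) uv show "(v \<cdot> f \<cdot> u, v \<cdot> g \<cdot> u) \<in> R" by (auto simp: congruence_def)
  qed
  ultimately show "congruence C (congruence_closure C S)"
    using par unfolding congruence_def by auto
qed

definition R_left :: "('o, 'a) cat \<Rightarrow> 'a set \<Rightarrow> 'a rel" where
  "R_left C W = {(f, g). parallel C f g \<and>
     (\<exists>\<sigma>\<in>W. Dom C \<sigma> = Cod C f \<and> \<sigma> \<cdot>\<^bsub>C\<^esub> f = \<sigma> \<cdot>\<^bsub>C\<^esub> g)}"

definition R_right :: "('o, 'a) cat \<Rightarrow> 'a set \<Rightarrow> 'a rel" where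
  "R_right C W = {(f, g). parallel C f g \<and>
     (\<exists>s\<in>W. Cod C s = Dom C f \<and> f \<cdot>\<^bsub>C\<^esub> s = g \<cdot>\<^bsub>C\<^esub> s)}"

definition left_congruence :: "('o, 'a) cat \<Rightarrow> 'a set \<Rightarrow> 'a rel" where
  "left_congruence C W = congruence_closure C (R_left C W)"

definition right_congruence :: "('o, 'a) cat \<Rightarrow> 'a set \<Rightarrow> 'a rel" where
  "right_congruence C W = congruence_closure C (R_right C W)"


section \<open>Localization\<close>

definition inverts :: "'a set \<Rightarrow> ('p, 'b) cat \<Rightarrow> ('a \<Rightarrow> 'b) \<Rightarrow> bool" where
  "inverts W D Fa \<longleftrightarrow> (\<forall>w\<in>W. is_iso D (Fa w))"

text \<open>The universal property of \<open>(\<gamma>o, \<gamma>a) : C \<rightarrow> H\<close>. HOL cannot quantify over types inside a formula,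
  so the type of the test categories \<open>D\<close> is a parameter, given by the first argument.
  Uniqueness of the factorization is agreement on the objects and arrows of \<open>H\<close>.\<close>

definition is_localization ::
    "('q, 'c) cat itself \<Rightarrow> ('o, 'a) cat \<Rightarrow> 'a set \<Rightarrow> ('p, 'b) cat \<Rightarrow> ('o \<Rightarrow> 'p) \<Rightarrow> ('a \<Rightarrow> 'b) \<Rightarrow> bool"
  where
  "is_localization _ C W H \<gamma>o \<gamma>a \<longleftrightarrow>
     category H \<and> is_functor C H \<gamma>o \<gamma>a \<and> inverts W H \<gamma>a \<and>
     (\<forall>(D :: ('q, 'c) cat) Fo Fa.
        category D \<longrightarrow> is_functor C D Fo Fa \<longrightarrow> inverts W D Fa \<longrightarrow>
        (\<exists>Go Ga. is_functor H D Go Ga \<and>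
           (\<forall>A\<in>Obj C. Go (\<gamma>o A) = Fo A) \<and> (\<forall>f\<in>Arr C. Ga (\<gamma>a f) = Fa f) \<and>
           (\<forall>Go' Ga'. is_functor H D Go' Ga' \<longrightarrow>
              (\<forall>A\<in>Obj C. Go' (\<gamma>o A) = Fo A) \<longrightarrow> (\<forall>f\<in>Arr C. Ga' (\<gamma>a f) = Fa f) \<longrightarrow>
              (\<forall>X\<in>Obj H. Go' X = Go X) \<and> (\<forall>h\<in>Arr H. Ga' h = Ga h))))"

definition homotopy_relation :: "('o, 'a) cat \<Rightarrow> ('a \<Rightarrow> 'b) \<Rightarrow> 'a rel" where
  "homotopy_relation C \<gamma>a = {(f, g). parallel C f g \<and> \<gamma>a f = \<gamma>a g}"


section \<open>Existence of the localization\<close>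

text \<open>The Gabriel--Zisman construction. A zigzag is a word of letters \<open>Inl f\<close> (an arrow of \<open>C\<close>,
  traversed forwards) and \<open>Inr w\<close> (an arrow of \<open>W\<close>, traversed backwards), read in order of
  traversal. An arrow of the localization is an equivalence class of zigzags together with
  its two end points. The two theorems at the end of this section show that it satisfies the
  universal property with respect to categories of every type, and that the universal property
  with respect to categories of the type in which it lives already determines the
  homotopy relation.\<close>

type_synonym ('o, 'a) zigzag_class = "'o \<times> ('a + 'a) list set \<times> 'o"

lemma letter_iff [simp]: "Inl f \<in> F <+> V \<longleftrightarrow> f \<in> F" "Inr w \<in> F <+> V \<longleftrightarrow> w \<in> V"
  by auto

fun ltr_dom :: "('o, 'a) cat \<Rightarrow> 'a + 'a \<Rightarrow> 'o" where
  "ltr_dom C (Inl f) = Dom C f"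
| "ltr_dom C (Inr w) = Cod C w"

fun ltr_cod :: "('o, 'a) cat \<Rightarrow> 'a + 'a \<Rightarrow> 'o" where
  "ltr_cod C (Inl f) = Cod C f"
| "ltr_cod C (Inr w) = Dom C w"

fun zigzag :: "('o, 'a) cat \<Rightarrow> 'a set \<Rightarrow> 'o \<Rightarrow> ('a + 'a) list \<Rightarrow> 'o \<Rightarrow> bool" where
  "zigzag C W A [] B \<longleftrightarrow> A = B \<and> A \<in> Obj C"
| "zigzag C W A (x # p) B \<longleftrightarrow> x \<in> Arr C <+> W \<and> ltr_dom C x = A \<and> zigzag C W (ltr_cod C x) p B"

inductive zz_rule :: "('o, 'a) cat \<Rightarrow> 'a set \<Rightarrow> ('a + 'a) list \<Rightarrow> ('a + 'a) list \<Rightarrow> bool"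
  for C :: "('o, 'a) cat" and W :: "'a set" where
  zz_cmp: "\<lbrakk>f \<in> Arr C; g \<in> Arr C; Cod C f = Dom C g\<rbrakk> \<Longrightarrow> zz_rule C W [Inl f, Inl g] [Inl (g \<cdot>\<^bsub>C\<^esub> f)]"
| zz_idt: "A \<in> Obj C \<Longrightarrow> zz_rule C W [Inl (Idt C A)] []"
| zz_inv1: "w \<in> W \<Longrightarrow> zz_rule C W [Inl w, Inr w] []"
| zz_inv2: "w \<in> W \<Longrightarrow> zz_rule C W [Inr w, Inl w] []"

inductive zz_eq :: "('o, 'a) cat \<Rightarrow> 'a set \<Rightarrow> 'o \<Rightarrow> 'o \<Rightarrow> ('a + 'a) list \<Rightarrow> ('a + 'a) list \<Rightarrow> bool"
  for C :: "('o, 'a) cat" and W :: "'a set" and A :: 'o and B :: 'o where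
  zz_step: "\<lbrakk>zz_rule C W l r; zigzag C W A (u @ l @ v) B; zigzag C W A (u @ r @ v) B\<rbrakk>
    \<Longrightarrow> zz_eq C W A B (u @ l @ v) (u @ r @ v)"
| zz_refl: "zigzag C W A p B \<Longrightarrow> zz_eq C W A B p p"
| zz_sym: "zz_eq C W A B p q \<Longrightarrow> zz_eq C W A B q p"
| zz_trans: "\<lbrakk>zz_eq C W A B p q; zz_eq C W A B q r\<rbrakk> \<Longrightarrow> zz_eq C W A B p r"

definition zz_class ::
    "('o, 'a) cat \<Rightarrow> 'a set \<Rightarrow> 'o \<Rightarrow> ('a + 'a) list \<Rightarrow> 'o \<Rightarrow> ('o, 'a) zigzag_class" where
  "zz_class C W A p B = (A, {q. zz_eq C W A B p q}, B)"

definition Ho :: "('o, 'a) cat \<Rightarrow> 'a set \<Rightarrow> ('o, ('o, 'a) zigzag_class) cat" where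
  "Ho C W =
    \<lparr>Obj = Obj C,
     Arr = {zz_class C W A p B |A p B. zigzag C W A p B},
     Dom = (\<lambda>(A, P, B). A),
     Cod = (\<lambda>(A, P, B). B),
     Idt = (\<lambda>A. zz_class C W A [] A),
     Cmp = (\<lambda>(B, Q, E) (A, P, B'). (A, {r. \<exists>p\<in>P. \<exists>q\<in>Q. zz_eq C W A E (p @ q) r}, E))\<rparr>"

definition Ho_arr :: "('o, 'a) cat \<Rightarrow> 'a set \<Rightarrow> 'a \<Rightarrow> ('o, 'a) zigzag_class" where
  "Ho_arr C W f = zz_class C W (Dom C f) [Inl f] (Cod C f)"

lemma (in category) inverse_unique:
  assumes "inverse_arrows C f g" "inverse_arrows C f h"
  shows "g = h"
proof -
  have "g = g \<cdot> (f \<cdot> h)" using assms cmp_idt[of g] by (auto simp: inverse_arrows_def)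
  also have "\<dots> = (g \<cdot> f) \<cdot> h" using assms cmp_assoc[of h f g] by (auto simp: inverse_arrows_def)
  also have "\<dots> = h" using assms idt_cmp[of h] by (auto simp: inverse_arrows_def)
  finally show ?thesis .
qed

definition inv_arrow :: "('o, 'a) cat \<Rightarrow> 'a \<Rightarrow> 'a" where
  "inv_arrow C f = (SOME g. inverse_arrows C f g)"

lemma inv_arrow: "is_iso C f \<Longrightarrow> inverse_arrows C f (inv_arrow C f)"
  unfolding is_iso_def inv_arrow_def by (rule someI_ex)

fun zz_eval ::
    "('o, 'a) cat \<Rightarrow> ('p, 'b) cat \<Rightarrow> ('o \<Rightarrow> 'p) \<Rightarrow> ('a \<Rightarrow> 'b) \<Rightarrow> 'o \<Rightarrow> ('a + 'a) list \<Rightarrow> 'b" where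
  "zz_eval C D Fo Fa A [] = Idt D (Fo A)"
| "zz_eval C D Fo Fa A (x # p) =
     zz_eval C D Fo Fa (ltr_cod C x) p
       \<cdot>\<^bsub>D\<^esub> (case x of Inl f \<Rightarrow> Fa f | Inr w \<Rightarrow> inv_arrow D (Fa w))"

context category_with_weak_equivalences
begin

lemma zigzag_append:
  "zigzag C W A (p @ q) B \<longleftrightarrow> (\<exists>E. zigzag C W A p E \<and> zigzag C W E q B)"
proof (induction p arbitrary: A)
  case Nil
  have "zigzag C W A q B \<Longrightarrow> A \<in> Obj C"
    using weq_arr by (cases q) (auto simp: dom_obj cod_obj)
  then show ?case by auto
qed auto

lemma zigzag_obj: "zigzag C W A p B \<Longrightarrow> A \<in> Obj C \<and> B \<in> Obj C"
  using weq_arr by (induction p arbitrary: A) (auto simp: dom_obj cod_obj)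

lemma zz_eq_zigzag: "zz_eq C W A B p q \<Longrightarrow> zigzag C W A p B \<and> zigzag C W A q B"
  by (induction rule: zz_eq.induct) auto

lemma zz_eq_append1:
  "zz_eq C W A B p q \<Longrightarrow> zigzag C W B v E \<Longrightarrow> zz_eq C W A E (p @ v) (q @ v)"
proof (induction rule: zz_eq.induct)
  case (zz_step l r u v')
  then show ?case
    using zz_eq.zz_step[of C W l r A u "v' @ v" E] zigzag_append[of A "u @ l @ v'" v E]
      zigzag_append[of A "u @ r @ v'" v E] by auto
next
  case (zz_refl p)
  then show ?case using zigzag_append by (blast intro: zz_eq.zz_refl)
qed (blast intro: zz_eq.zz_sym zz_eq.zz_trans)+

lemma zz_eq_append2:
  "zz_eq C W B E p q \<Longrightarrow> zigzag C W A u B \<Longrightarrow> zz_eq C W A E (u @ p) (u @ q)"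
proof (induction rule: zz_eq.induct)
  case (zz_step l r u' v)
  then show ?case
    using zz_eq.zz_step[of C W l r A "u @ u'" v E] zigzag_append[of A u "u' @ l @ v" E]
      zigzag_append[of A u "u' @ r @ v" E] by auto
next
  case (zz_refl p)
  then show ?case using zigzag_append by (blast intro: zz_eq.zz_refl)
qed (blast intro: zz_eq.zz_sym zz_eq.zz_trans)+

lemma zz_eq_append:
  assumes "zz_eq C W A B p p'" "zz_eq C W B E q q'"
  shows "zz_eq C W A E (p @ q) (p' @ q')"
  using zz_eq_append1[OF assms(1)] zz_eq_append2[OF assms(2)] zz_eq_zigzag[OF assms(1)]
    zz_eq_zigzag[OF assms(2)] by (blast intro: zz_eq.zz_trans)

lemma zz_class_eq:
  assumes "zigzag C W A p B"
  shows "zz_class C W A p B = zz_class C W A q B \<longleftrightarrow> zz_eq C W A B p q"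
proof
  assume "zz_class C W A p B = zz_class C W A q B"
  then have "{r. zz_eq C W A B p r} = {r. zz_eq C W A B q r}" by (simp add: zz_class_def)
  then have "zz_eq C W A B q p" using zz_eq.zz_refl[OF assms] by blast
  then show "zz_eq C W A B p q" by (rule zz_eq.zz_sym)
next
  assume "zz_eq C W A B p q"
  then have "zz_eq C W A B p r \<longleftrightarrow> zz_eq C W A B q r" for r
    by (blast intro: zz_eq.zz_sym zz_eq.zz_trans)
  then show "zz_class C W A p B = zz_class C W A q B" by (simp add: zz_class_def)
qed

lemma zz_class_eqI: "zz_eq C W A B p q \<Longrightarrow> zz_class C W A p B = zz_class C W A q B"
  using zz_class_eq zz_eq_zigzag by blast

lemma Ho_cmp:
  assumes "zigzag C W A p B" "zigzag C W B q E"
  shows "zz_class C W B q E \<cdot>\<^bsub>Ho C W\<^esub> zz_class C W A p B = zz_class C W A (p @ q) E"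
proof -
  have "(\<exists>p'. zz_eq C W A B p p' \<and> (\<exists>q'. zz_eq C W B E q q' \<and> zz_eq C W A E (p' @ q') r)) \<longleftrightarrow>
      zz_eq C W A E (p @ q) r" for r
    using assms zz_eq_append by (blast intro: zz_eq.zz_refl zz_eq.zz_trans)
  then show ?thesis by (simp add: Ho_def zz_class_def Bex_def)
qed

lemma Ho_simps:
  "Obj (Ho C W) = Obj C"
  "Idt (Ho C W) A = zz_class C W A [] A"
  "Dom (Ho C W) (zz_class C W A p B) = A"
  "Cod (Ho C W) (zz_class C W A p B) = B"
  by (simp_all add: Ho_def zz_class_def)

lemma Ho_arrI: "zigzag C W A p B \<Longrightarrow> zz_class C W A p B \<in> Arr (Ho C W)"
  by (auto simp: Ho_def)

lemma Ho_arrE: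
  assumes "h \<in> Arr (Ho C W)"
  obtains A p B where "h = zz_class C W A p B" "zigzag C W A p B"
  using assms by (auto simp: Ho_def)

lemma category_Ho: "category (Ho C W)"
proof
  fix f assume "f \<in> Arr (Ho C W)"
  then obtain A p B where f: "f = zz_class C W A p B" "zigzag C W A p B" by (rule Ho_arrE)
  note z = zigzag_obj[OF f(2)]
  show "Dom (Ho C W) f \<in> Obj (Ho C W)" "Cod (Ho C W) f \<in> Obj (Ho C W)"
    using f z by (auto simp: Ho_simps)
  show "f \<cdot>\<^bsub>Ho C W\<^esub> Idt (Ho C W) (Dom (Ho C W) f) = f"
    "Idt (Ho C W) (Cod (Ho C W) f) \<cdot>\<^bsub>Ho C W\<^esub> f = f"
    using f z Ho_cmp[of A "[]" A p B] Ho_cmp[of A p B "[]" B] by (auto simp: Ho_simps)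
next
  fix A assume "A \<in> Obj (Ho C W)"
  then show "Idt (Ho C W) A \<in> Arr (Ho C W)" "Dom (Ho C W) (Idt (Ho C W) A) = A"
    "Cod (Ho C W) (Idt (Ho C W) A) = A"
    by (auto simp: Ho_simps intro!: Ho_arrI)
next
  fix f g assume "f \<in> Arr (Ho C W)" "g \<in> Arr (Ho C W)"
    and comp: "Cod (Ho C W) f = Dom (Ho C W) g"
  then obtain A p B B' q E where f: "f = zz_class C W A p B" "zigzag C W A p B"
    and g: "g = zz_class C W B' q E" "zigzag C W B' q E"
    by (metis Ho_arrE)
  have B: "B' = B" using comp f g by (simp add: Ho_simps)
  have gf: "g \<cdot>\<^bsub>Ho C W\<^esub> f = zz_class C W A (p @ q) E" "zigzag C W A (p @ q) E"
    using f g B Ho_cmp by (auto simp: zigzag_append)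
  show "g \<cdot>\<^bsub>Ho C W\<^esub> f \<in> Arr (Ho C W)"
    "Dom (Ho C W) (g \<cdot>\<^bsub>Ho C W\<^esub> f) = Dom (Ho C W) f"
    "Cod (Ho C W) (g \<cdot>\<^bsub>Ho C W\<^esub> f) = Cod (Ho C W) g"
    using f g gf by (auto simp: Ho_simps intro: Ho_arrI)
  fix h assume "h \<in> Arr (Ho C W)" and comp': "Cod (Ho C W) g = Dom (Ho C W) h"
  then obtain E' r K where h: "h = zz_class C W E' r K" "zigzag C W E' r K"
    by (metis Ho_arrE)
  have E: "E' = E" using comp' g h by (simp add: Ho_simps)
  have hg: "h \<cdot>\<^bsub>Ho C W\<^esub> g = zz_class C W B (q @ r) K" "zigzag C W B (q @ r) K"
    using g h B E Ho_cmp by (auto simp: zigzag_append)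
  show "(h \<cdot>\<^bsub>Ho C W\<^esub> g) \<cdot>\<^bsub>Ho C W\<^esub> f = h \<cdot>\<^bsub>Ho C W\<^esub> g \<cdot>\<^bsub>Ho C W\<^esub> f"
    using Ho_cmp[OF f(2) hg(2)] Ho_cmp[OF gf(2), of r K] h E gf hg f by simp
qed

lemma zigzag_single: "f \<in> Arr C \<Longrightarrow> zigzag C W (Dom C f) [Inl f] (Cod C f)"
  by (auto simp: cod_obj)

lemma functor_Ho: "is_functor C (Ho C W) (\<lambda>A. A) (Ho_arr C W)"
  unfolding is_functor_def
proof (intro conjI ballI impI)
  fix A assume A: "A \<in> Obj C"
  then show "A \<in> Obj (Ho C W)" by (simp add: Ho_simps)
  show "Ho_arr C W (Idt C A) = Idt (Ho C W) A"
    using A zz_eq.zz_step[OF zz_idt[OF A, of W], of A "[]" "[]" A]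
    by (auto simp: Ho_arr_def Ho_simps dom_idt cod_idt idt_arr intro!: zz_class_eqI)
next
  fix f assume f: "f \<in> Arr C"
  then show "Ho_arr C W f \<in> Arr (Ho C W)"
    unfolding Ho_arr_def by (intro Ho_arrI zigzag_single)
  show "Dom (Ho C W) (Ho_arr C W f) = Dom C f" "Cod (Ho C W) (Ho_arr C W f) = Cod C f"
    by (simp_all add: Ho_arr_def Ho_simps)
  fix g assume g: "g \<in> Arr C" and fg: "Cod C f = Dom C g"
  have "Ho_arr C W g \<cdot>\<^bsub>Ho C W\<^esub> Ho_arr C W f = zz_class C W (Dom C f) [Inl f, Inl g] (Cod C g)"
    using Ho_cmp[OF zigzag_single[OF f], of "[Inl g]" "Cod C g"] zigzag_single[OF g] fg
    by (simp add: Ho_arr_def)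
  also have "\<dots> = Ho_arr C W (g \<cdot> f)"
    using f g fg zz_eq.zz_step[OF zz_cmp[OF f g fg, of W], of "Dom C f" "[]" "[]" "Cod C g"]
    by (auto simp: Ho_arr_def dom_cmp cod_cmp cmp_arr cod_obj intro!: zz_class_eqI)
  finally show "Ho_arr C W (g \<cdot> f) = Ho_arr C W g \<cdot>\<^bsub>Ho C W\<^esub> Ho_arr C W f" by simp
qed

lemma Ho_inverse:
  assumes w: "w \<in> W"
  shows "inverse_arrows (Ho C W) (Ho_arr C W w) (zz_class C W (Cod C w) [Inr w] (Dom C w))"
proof -
  have wa: "w \<in> Arr C" using w weq_arr by auto
  have z: "zigzag C W (Cod C w) [Inr w] (Dom C w)" using w wa by (auto simp: dom_obj)
  note zw = zigzag_single[OF wa]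
  have 1: "zz_class C W (Dom C w) [Inl w, Inr w] (Dom C w) = zz_class C W (Dom C w) [] (Dom C w)"
    using zz_eq.zz_step[OF zz_inv1[OF w], of C "Dom C w" "[]" "[]" "Dom C w"] w wa
    by (auto simp: dom_obj intro!: zz_class_eqI)
  have 2: "zz_class C W (Cod C w) [Inr w, Inl w] (Cod C w) = zz_class C W (Cod C w) [] (Cod C w)"
    using zz_eq.zz_step[OF zz_inv2[OF w], of C "Cod C w" "[]" "[]" "Cod C w"] w wa
    by (auto simp: cod_obj intro!: zz_class_eqI)
  show ?thesis
    unfolding inverse_arrows_def
    using Ho_cmp[OF zw z] Ho_cmp[OF z zw] Ho_arrI[OF z] Ho_arrI[OF zw] 1 2
    by (simp add: Ho_arr_def Ho_simps)
qed

lemma inverts_Ho: "inverts W (Ho C W) (Ho_arr C W)"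
  using Ho_inverse unfolding inverts_def is_iso_def by blast

context
  fixes D :: "('q, 'c) cat" and Fo Fa
  assumes D: "category D" and F: "is_functor C D Fo Fa" and inv: "inverts W D Fa"
begin

interpretation D: category D by (rule D)

lemma letter_eval:
  assumes "x \<in> Arr C <+> W"
  defines "e \<equiv> (case x of Inl f \<Rightarrow> Fa f | Inr w \<Rightarrow> inv_arrow D (Fa w))"
  shows "e \<in> Arr D" "Dom D e = Fo (ltr_dom C x)" "Cod D e = Fo (ltr_cod C x)"
proof -
  have w: "inverse_arrows D (Fa w) (inv_arrow D (Fa w))" if "w \<in> W" for w
    using that inv inv_arrow[of D] by (auto simp: inverts_def)
  have "e \<in> Arr D \<and> Dom D e = Fo (ltr_dom C x) \<and> Cod D e = Fo (ltr_cod C x)"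
    using assms(1) w F weq_arr
    by (cases x) (auto simp: e_def is_functor_def inverse_arrows_def)
  then show "e \<in> Arr D" "Dom D e = Fo (ltr_dom C x)" "Cod D e = Fo (ltr_cod C x)" by auto
qed

lemma zz_eval_arr:
  "zigzag C W A p B \<Longrightarrow> zz_eval C D Fo Fa A p \<in> Arr D \<and>
     Dom D (zz_eval C D Fo Fa A p) = Fo A \<and> Cod D (zz_eval C D Fo Fa A p) = Fo B"
proof (induction p arbitrary: A)
  case Nil
  then show ?case using F D.idt_arr D.dom_idt D.cod_idt by (auto simp: is_functor_def)
next
  case (Cons x p)
  then show ?case using letter_eval[of x] by (auto simp: D.cmp_arr D.dom_cmp D.cod_cmp)
qed

lemma zz_eval_append:
  "zigzag C W A p B \<Longrightarrow> zigzag C W B q E \<Longrightarrow>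
     zz_eval C D Fo Fa A (p @ q) = zz_eval C D Fo Fa B q \<cdot>\<^bsub>D\<^esub> zz_eval C D Fo Fa A p"
proof (induction p arbitrary: A)
  case Nil
  then show ?case using zz_eval_arr[of B q E] D.cmp_idt[of "zz_eval C D Fo Fa B q"] by auto
next
  case (Cons x p)
  then show ?case
    using letter_eval[of x] zz_eval_arr[of "ltr_cod C x" p B] zz_eval_arr[of B q E]
    by (auto simp: D.cmp_assoc)
qed

lemma zz_eval_single:
  assumes "x \<in> Arr C <+> W"
  shows "zz_eval C D Fo Fa A [x] = (case x of Inl f \<Rightarrow> Fa f | Inr w \<Rightarrow> inv_arrow D (Fa w))"
  using letter_eval[OF assms]
    D.idt_cmp[of "case x of Inl f \<Rightarrow> Fa f | Inr w \<Rightarrow> inv_arrow D (Fa w)"] by simp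

lemma zz_eval_rule:
  assumes "zz_rule C W l r" "zigzag C W A l B"
  shows "zz_eval C D Fo Fa A l = zz_eval C D Fo Fa A r"
  using assms
proof (cases rule: zz_rule.cases)
  case (zz_cmp f g)
  then show ?thesis
    using zz_eval_append[of A "[Inl f]" "Cod C f" "[Inl g]" B] assms(2) F
      zz_eval_single[of "Inl f"] zz_eval_single[of "Inl g"] zz_eval_single[of "Inl (g \<cdot> f)"]
    by (auto simp: is_functor_def cmp_arr dom_obj simp del: zz_eval.simps(2))
next
  case (zz_idt A')
  then show ?thesis
    using assms(2) zz_eval_single[of "Inl (Idt C A')"] F
    by (auto simp: is_functor_def idt_arr dom_idt simp del: zz_eval.simps(2))
next
  case (zz_inv1 w)
  then have "inverse_arrows D (Fa w) (inv_arrow D (Fa w))" "w \<in> Arr C"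
    using inv inv_arrow[of D] weq_arr by (auto simp: inverts_def)
  then show ?thesis
    using zz_inv1 zz_eval_append[of A "[Inl w]" "Cod C w" "[Inr w]" B] assms(2) F
      zz_eval_single[of "Inl w"] zz_eval_single[of "Inr w"]
    by (auto simp: is_functor_def inverse_arrows_def cod_obj simp del: zz_eval.simps(2))
next
  case (zz_inv2 w)
  then have "inverse_arrows D (Fa w) (inv_arrow D (Fa w))" "w \<in> Arr C"
    using inv inv_arrow[of D] weq_arr by (auto simp: inverts_def)
  then show ?thesis
    using zz_inv2 zz_eval_append[of A "[Inr w]" "Dom C w" "[Inl w]" B] assms(2) F
      zz_eval_single[of "Inl w"] zz_eval_single[of "Inr w"]
    by (auto simp: is_functor_def inverse_arrows_def dom_obj simp del: zz_eval.simps(2))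
qed

lemma zz_rule_ends:
  assumes "zz_rule C W l r" "zigzag C W A l B"
  shows "zigzag C W A r B"
  using assms weq_arr
  by (cases rule: zz_rule.cases) (auto simp: cmp_arr dom_cmp cod_cmp dom_idt cod_idt dom_obj)

lemma zz_eval_eq:
  "zz_eq C W A B p q \<Longrightarrow> zz_eval C D Fo Fa A p = zz_eval C D Fo Fa A q"
proof (induction rule: zz_eq.induct)
  case (zz_step l r u v)
  from zz_step(2) obtain E K where
    u: "zigzag C W A u E" and l: "zigzag C W E l K" and v: "zigzag C W K v B"
    by (auto simp: zigzag_append)
  have r: "zigzag C W E r K" using zz_rule_ends[OF zz_step(1) l] .
  have lv: "zigzag C W E (l @ v) B" and rv: "zigzag C W E (r @ v) B"
    using l r v by (auto simp: zigzag_append)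
  show ?case
    using zz_eval_append[OF u lv] zz_eval_append[OF u rv] zz_eval_append[OF l v]
      zz_eval_append[OF r v] zz_eval_rule[OF zz_step(1) l] by simp
qed auto

lemma Ho_factorization:
  "\<exists>Go Ga. is_functor (Ho C W) D Go Ga \<and>
     (\<forall>A\<in>Obj C. Go A = Fo A) \<and> (\<forall>f\<in>Arr C. Ga (Ho_arr C W f) = Fa f) \<and>
     (\<forall>Go' Ga'. is_functor (Ho C W) D Go' Ga' \<longrightarrow>
        (\<forall>A\<in>Obj C. Go' A = Fo A) \<longrightarrow> (\<forall>f\<in>Arr C. Ga' (Ho_arr C W f) = Fa f) \<longrightarrow>
        (\<forall>X\<in>Obj (Ho C W). Go' X = Go X) \<and> (\<forall>h\<in>Arr (Ho C W). Ga' h = Ga h))"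
proof -
  define Ga where "Ga = (\<lambda>(A :: 'o, P :: ('a + 'a) list set, B :: 'o). zz_eval C D Fo Fa A (SOME p. p \<in> P))"
  have Ga: "Ga (zz_class C W A p B) = zz_eval C D Fo Fa A p" if "zigzag C W A p B" for A p B
  proof -
    have "zz_eq C W A B p (SOME q. zz_eq C W A B p q)"
      using zz_eq.zz_refl[OF that] by (rule someI)
    then show ?thesis using zz_eval_eq by (auto simp: Ga_def zz_class_def)
  qed
  have "is_functor (Ho C W) D Fo Ga"
    unfolding is_functor_def
  proof (intro conjI ballI impI)
    fix A assume "A \<in> Obj (Ho C W)"
    then have A: "A \<in> Obj C" by (simp add: Ho_simps)
    then show "Fo A \<in> Obj D" using F by (simp add: is_functor_def)
    show "Ga (Idt (Ho C W) A) = Idt D (Fo A)" using A by (simp add: Ho_simps Ga)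
  next
    fix f assume "f \<in> Arr (Ho C W)"
    then obtain A p B where f: "f = zz_class C W A p B" "zigzag C W A p B" by (rule Ho_arrE)
    show "Ga f \<in> Arr D" "Dom D (Ga f) = Fo (Dom (Ho C W) f)" "Cod D (Ga f) = Fo (Cod (Ho C W) f)"
      using f zz_eval_arr[OF f(2)] by (auto simp: Ga Ho_simps)
    fix g assume "g \<in> Arr (Ho C W)" and comp: "Cod (Ho C W) f = Dom (Ho C W) g"
    then obtain B' q E where g: "g = zz_class C W B' q E" "zigzag C W B' q E"
      by (metis Ho_arrE)
    have B: "B' = B" using comp f g by (simp add: Ho_simps)
    have pq: "zigzag C W A (p @ q) E" using f g B by (auto simp: zigzag_append)
    show "Ga (g \<cdot>\<^bsub>Ho C W\<^esub> f) = Ga g \<cdot>\<^bsub>D\<^esub> Ga f"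
      using f g B Ho_cmp zz_eval_append[of A p B q E] Ga[OF pq] by (simp add: Ga)
  qed
  moreover have "\<forall>f\<in>Arr C. Ga (Ho_arr C W f) = Fa f"
    using Ga[OF zigzag_single] zz_eval_single[of "Inl _"]
    by (auto simp: Ho_arr_def simp del: zz_eval.simps(2))
  moreover have "\<forall>h\<in>Arr (Ho C W). Ga' h = Ga h"
    if G': "is_functor (Ho C W) D Go' Ga'" and Go': "\<forall>A\<in>Obj C. Go' A = Fo A"
      and Ga': "\<forall>f\<in>Arr C. Ga' (Ho_arr C W f) = Fa f" for Go' Ga'
  proof -
    have letter: "Ga' (zz_class C W (ltr_dom C x) [x] (ltr_cod C x)) =
        (case x of Inl f \<Rightarrow> Fa f | Inr w \<Rightarrow> inv_arrow D (Fa w))" if x: "x \<in> Arr C <+> W" for x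
    proof (cases x)
      case (Inl f)
      then show ?thesis using x Ga' by (auto simp: Ho_arr_def)
    next
      case (Inr w)
      then have w: "w \<in> W" "w \<in> Arr C" using x weq_arr by auto
      let ?i = "zz_class C W (Cod C w) [Inr w] (Dom C w)"
      have i: "inverse_arrows (Ho C W) (Ho_arr C W w) ?i" by (rule Ho_inverse[OF w(1)])
      have Dw: "Dom (Ho C W) (Ho_arr C W w) = Dom C w" "Cod (Ho C W) (Ho_arr C W w) = Cod C w"
        by (simp_all add: Ho_arr_def Ho_simps)
      have "inverse_arrows D (Ga' (Ho_arr C W w)) (Ga' ?i)"
        unfolding inverse_arrows_def
      proof (intro conjI)
        let ?w = "Ho_arr C W w"
        have a: "?w \<in> Arr (Ho C W)" "?i \<in> Arr (Ho C W)" "Dom (Ho C W) ?i = Cod C w"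
          "Cod (Ho C W) ?i = Dom C w" "?i \<cdot>\<^bsub>Ho C W\<^esub> ?w = Idt (Ho C W) (Dom C w)"
          "?w \<cdot>\<^bsub>Ho C W\<^esub> ?i = Idt (Ho C W) (Cod C w)"
          using i Dw by (auto simp: inverse_arrows_def)
        have o: "Dom C w \<in> Obj (Ho C W)" "Cod C w \<in> Obj (Ho C W)"
          using w by (auto simp: Ho_simps dom_obj cod_obj)
        show "Ga' ?w \<in> Arr D" "Ga' ?i \<in> Arr D" "Dom D (Ga' ?i) = Cod D (Ga' ?w)"
          "Cod D (Ga' ?i) = Dom D (Ga' ?w)"
          using G' a Dw by (auto simp: is_functor_def)
        have "Ga' ?i \<cdot>\<^bsub>D\<^esub> Ga' ?w = Ga' (?i \<cdot>\<^bsub>Ho C W\<^esub> ?w)"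
          "Ga' ?w \<cdot>\<^bsub>D\<^esub> Ga' ?i = Ga' (?w \<cdot>\<^bsub>Ho C W\<^esub> ?i)"
          using G' a(1-4) Dw by (simp_all add: is_functor_def)
        then show "Ga' ?i \<cdot>\<^bsub>D\<^esub> Ga' ?w = Idt D (Dom D (Ga' ?w))"
          "Ga' ?w \<cdot>\<^bsub>D\<^esub> Ga' ?i = Idt D (Cod D (Ga' ?w))"
          using G' a Dw o by (simp_all add: is_functor_def)
      qed
      moreover have "Ga' (Ho_arr C W w) = Fa w" using Ga' w by auto
      moreover have "inverse_arrows D (Fa w) (inv_arrow D (Fa w))"
        using w inv inv_arrow[of D] by (auto simp: inverts_def)
      ultimately show ?thesis using Inr D.inverse_unique by simp
    qed
    have "zigzag C W A p B \<Longrightarrow> Ga' (zz_class C W A p B) = zz_eval C D Fo Fa A p" for A p B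
    proof (induction p arbitrary: A)
      case Nil
      then have "A \<in> Obj (Ho C W)" "A = B" by (auto simp: Ho_simps)
      then show ?case using G' Go' by (auto simp: is_functor_def Ho_simps(1,2))
    next
      case (Cons x p)
      let ?E = "ltr_cod C x"
      have x: "x \<in> Arr C <+> W" "A = ltr_dom C x" "zigzag C W ?E p B" using Cons.prems by auto
      have zx: "zigzag C W A [x] ?E" using x zigzag_obj[OF x(3)] by auto
      have "Ga' (zz_class C W ?E p B \<cdot>\<^bsub>Ho C W\<^esub> zz_class C W A [x] ?E) =
          Ga' (zz_class C W ?E p B) \<cdot>\<^bsub>D\<^esub> Ga' (zz_class C W A [x] ?E)"
        using G' Ho_arrI[OF zx] Ho_arrI[OF x(3)] by (simp add: is_functor_def Ho_simps)
      then show ?case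
        using Ho_cmp[OF zx x(3)] letter[OF x(1)] Cons.IH[OF x(3)] x(2) by simp
    qed
    then show ?thesis using Ga by (metis Ho_arrE)
  qed
  ultimately show ?thesis by (auto simp: Ho_simps(1) intro!: exI[of _ Fo] exI[of _ Ga])
qed

end

theorem is_localization_Ho: "is_localization T C W (Ho C W) (\<lambda>A. A) (Ho_arr C W)"
  unfolding is_localization_def
  by (intro conjI allI impI category_Ho functor_Ho inverts_Ho Ho_factorization)

theorem homotopy_relation_unique:
  assumes "is_localization TYPE(('o, ('o, 'a) zigzag_class) cat) C W H \<gamma>o \<gamma>a"
  shows "homotopy_relation C \<gamma>a = homotopy_relation C (Ho_arr C W)"
proof -
  from assms obtain Go Ga where "\<forall>f\<in>Arr C. Ga (\<gamma>a f) = Ho_arr C W f"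
    unfolding is_localization_def using category_Ho functor_Ho inverts_Ho by meson
  moreover from assms have "category H" "is_functor C H \<gamma>o \<gamma>a" "inverts W H \<gamma>a"
    by (auto simp: is_localization_def)
  from Ho_factorization[OF this] obtain Ga' where "\<forall>f\<in>Arr C. Ga' (Ho_arr C W f) = \<gamma>a f"
    by blast
  ultimately show ?thesis
    unfolding homotopy_relation_def parallel_def by (auto, metis+)
qed

end

end

theory Submission
  imports Defs
begin

text \<open>
  Each of the two generated congruences is compared with the homotopy relation, which is the kernel
  of the localization functor. In one direction, the kernel of a functor \<open>F\<close> is a congruence, and
  if \<open>F\<close> inverts the weak equivalences then \<open>F \<sigma>\<close> can be cancelled from \<open>F \<sigma> \<cdot> F f = F \<sigma> \<cdot> F g\<close>, and
  similarly on the right; so the homotopy relation contains both \<open>R_left\<close> and \<open>R_right\<close>, hence the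
  congruences which they generate (\<open>congruence_functor_kernel\<close>, \<open>R_left_subset_kernel\<close>,
  \<open>R_right_subset_kernel\<close>).

  In the other direction, let \<open>R\<close> be a congruence containing \<open>R_left\<close> or \<open>R_right\<close>. If \<open>r \<cdot> s = 1\<close>
  with \<open>r\<close> and \<open>s\<close> weak equivalences, then \<open>s \<cdot> r\<close> and \<open>1\<close> agree after composition with \<open>r\<close> on the
  left, and also after composition with \<open>s\<close> on the right, so \<open>R\<close> relates them: \<open>r\<close> and \<open>s\<close> become
  inverse to each other in the quotient category \<open>C/R\<close> (\<open>retract_idempotent_R\<close>). By the two out of
  three property the one-sided inverse of a split weak equivalence is a weak equivalence, so the
  quotient functor inverts all split weak equivalences, and therefore, when these generate, all of
  \<open>W\<close> (\<open>quotient_inverts\<close>). Hence it factors through the localization: arrows identified there are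
  already related by \<open>R\<close> (\<open>homotopy_relation_subset\<close>). The pair \<open>(s \<cdot> r, 1)\<close> lies in both \<open>R_left\<close>
  and \<open>R_right\<close>, so a single argument, for congruences containing their intersection, serves both
  sides.
\<close>

section \<open>Isomorphisms\<close>

context category
begin

lemma is_iso_cmp:
  assumes f: "is_iso C f" and g: "is_iso C g" and fg: "Cod C f = Dom C g"
  shows "is_iso C (g \<cdot> f)"
proof -
  obtain f' where f': "f \<in> Arr C" "f' \<in> Arr C" "Dom C f' = Cod C f" "Cod C f' = Dom C f"
    "f' \<cdot> f = Idt C (Dom C f)" "f \<cdot> f' = Idt C (Cod C f)"
    using f by (auto simp: is_iso_def inverse_arrows_def)
  obtain g' where g': "g \<in> Arr C" "g' \<in> Arr C" "Dom C g' = Cod C g" "Cod C g' = Dom C g"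
    "g' \<cdot> g = Idt C (Dom C g)" "g \<cdot> g' = Idt C (Cod C g)"
    using g by (auto simp: is_iso_def inverse_arrows_def)
  have "g' \<cdot> (g \<cdot> f) = f"
    using f' g' fg cmp_assoc[of f g g'] idt_cmp[of f] by simp
  then have 1: "(f' \<cdot> g') \<cdot> (g \<cdot> f) = Idt C (Dom C f)"
    using f' g' fg cmp_assoc[of "g \<cdot> f" g' f'] by (simp add: cmp_arr cod_cmp)
  have "f \<cdot> (f' \<cdot> g') = g'"
    using f' g' fg cmp_assoc[of g' f' f] idt_cmp[of g'] by simp
  then have 2: "(g \<cdot> f) \<cdot> (f' \<cdot> g') = Idt C (Cod C g)"
    using f' g' fg cmp_assoc[of "f' \<cdot> g'" f g] by (simp add: cmp_arr cod_cmp)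
  have "inverse_arrows C (g \<cdot> f) (f' \<cdot> g')"
    using 1 2 f' g' fg by (simp add: inverse_arrows_def cmp_arr dom_cmp cod_cmp)
  then show ?thesis by (auto simp: is_iso_def)
qed

lemma iso_cancel_left:
  assumes s: "is_iso C s" and fg: "parallel C f g" and "Cod C f = Dom C s"
    and eq: "s \<cdot> f = s \<cdot> g"
  shows "f = g"
proof -
  obtain t where t: "s \<in> Arr C" "t \<in> Arr C" "Dom C t = Cod C s" "Cod C t = Dom C s"
    "t \<cdot> s = Idt C (Dom C s)"
    using s by (auto simp: is_iso_def inverse_arrows_def)
  have "h = t \<cdot> (s \<cdot> h)" if "h \<in> Arr C" "Cod C h = Dom C s" for h
    using that t cmp_assoc[of h s t] idt_cmp[of h] by simp
  then show ?thesis using assms by (metis parallel_def)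
qed

lemma iso_cancel_right:
  assumes s: "is_iso C s" and fg: "parallel C f g" and "Cod C s = Dom C f"
    and eq: "f \<cdot> s = g \<cdot> s"
  shows "f = g"
proof -
  obtain t where t: "s \<in> Arr C" "t \<in> Arr C" "Dom C t = Cod C s" "Cod C t = Dom C s"
    "s \<cdot> t = Idt C (Cod C s)"
    using s by (auto simp: is_iso_def inverse_arrows_def)
  have "h = (h \<cdot> s) \<cdot> t" if "h \<in> Arr C" "Dom C h = Cod C s" for h
    using that t cmp_assoc[of t s h] cmp_idt[of h] by simp
  then show ?thesis using assms by (metis parallel_def)
qed

end


section \<open>Kernels of functors\<close>

lemma (in category) congruence_functor_kernel:
  assumes F: "is_functor C D Fo Fa"
  shows "congruence C (homotopy_relation C Fa)"
proof -
  have "equiv (Arr C) (homotopy_relation C Fa)"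
    by (rule equivI)
      (auto simp: homotopy_relation_def parallel_def refl_on_def sym_def trans_def)
  moreover have "(v \<cdot> f \<cdot> u, v \<cdot> g \<cdot> u) \<in> homotopy_relation C Fa"
    if "(f, g) \<in> homotopy_relation C Fa" "u \<in> Arr C" "v \<in> Arr C"
      "Cod C u = Dom C f" "Cod C f = Dom C v" for f g u v
    using that F
    by (simp add: homotopy_relation_def parallel_def is_functor_def cmp_arr dom_cmp cod_cmp)
  ultimately show ?thesis
    unfolding congruence_def by (auto simp: homotopy_relation_def)
qed

context category_with_weak_equivalences
begin

lemma R_left_subset_kernel:
  assumes D: "category D" and F: "is_functor C D Fo Fa" and inv: "inverts W D Fa"
  shows "R_left C W \<subseteq> homotopy_relation C Fa"
proof clarify
  interpret D: category D by (rule D)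
  fix f g assume "(f, g) \<in> R_left C W"
  then obtain s where p: "parallel C f g" and s: "s \<in> W" "Dom C s = Cod C f" "s \<cdot> f = s \<cdot> g"
    by (auto simp: R_left_def)
  have sa: "s \<in> Arr C" using s weq_arr by auto
  have iso: "is_iso D (Fa s)" using inv s by (auto simp: inverts_def)
  have "Fa s \<cdot>\<^bsub>D\<^esub> Fa f = Fa (s \<cdot> f)" "Fa s \<cdot>\<^bsub>D\<^esub> Fa g = Fa (s \<cdot> g)"
    using F p s(2) sa by (simp_all add: is_functor_def parallel_def)
  then have eq: "Fa s \<cdot>\<^bsub>D\<^esub> Fa f = Fa s \<cdot>\<^bsub>D\<^esub> Fa g" using s by simp
  have "parallel D (Fa f) (Fa g)" "Cod D (Fa f) = Dom D (Fa s)"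
    using F p s sa by (auto simp: is_functor_def parallel_def)
  from D.iso_cancel_left[OF iso this eq] show "(f, g) \<in> homotopy_relation C Fa"
    using p by (simp add: homotopy_relation_def)
qed

lemma R_right_subset_kernel:
  assumes D: "category D" and F: "is_functor C D Fo Fa" and inv: "inverts W D Fa"
  shows "R_right C W \<subseteq> homotopy_relation C Fa"
proof clarify
  interpret D: category D by (rule D)
  fix f g assume "(f, g) \<in> R_right C W"
  then obtain s where p: "parallel C f g" and s: "s \<in> W" "Cod C s = Dom C f" "f \<cdot> s = g \<cdot> s"
    by (auto simp: R_right_def)
  have sa: "s \<in> Arr C" using s weq_arr by auto
  have iso: "is_iso D (Fa s)" using inv s by (auto simp: inverts_def)
  have "Fa f \<cdot>\<^bsub>D\<^esub> Fa s = Fa (f \<cdot> s)" "Fa g \<cdot>\<^bsub>D\<^esub> Fa s = Fa (g \<cdot> s)"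
    using F p s(2) sa by (simp_all add: is_functor_def parallel_def)
  then have eq: "Fa f \<cdot>\<^bsub>D\<^esub> Fa s = Fa g \<cdot>\<^bsub>D\<^esub> Fa s" using s by simp
  have "parallel D (Fa f) (Fa g)" "Cod D (Fa s) = Dom D (Fa f)"
    using F p s sa by (auto simp: is_functor_def parallel_def)
  from D.iso_cancel_right[OF iso this eq] show "(f, g) \<in> homotopy_relation C Fa"
    using p by (simp add: homotopy_relation_def)
qed

end


section \<open>The quotient by a congruence\<close>

text \<open>An arrow of the quotient category is represented by a chosen member of its class, so that
  its end points are read off as in \<open>C\<close>.\<close>

definition class_rep :: "'a rel \<Rightarrow> 'a \<Rightarrow> 'a" where
  "class_rep R f = (SOME g. (f, g) \<in> R)"

definition quotient_cat :: "('o, 'a) cat \<Rightarrow> 'a rel \<Rightarrow> ('o, 'a) cat" where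
  "quotient_cat C R =
    \<lparr>Obj = Obj C,
     Arr = class_rep R ` Arr C,
     Dom = Dom C,
     Cod = Cod C,
     Idt = (\<lambda>A. class_rep R (Idt C A)),
     Cmp = (\<lambda>g f. class_rep R (g \<cdot>\<^bsub>C\<^esub> f))\<rparr>"

lemma quotient_cat_simps:
  "Obj (quotient_cat C R) = Obj C"
  "Arr (quotient_cat C R) = class_rep R ` Arr C"
  "Dom (quotient_cat C R) = Dom C"
  "Cod (quotient_cat C R) = Cod C"
  "Idt (quotient_cat C R) A = class_rep R (Idt C A)"
  "g \<cdot>\<^bsub>quotient_cat C R\<^esub> f = class_rep R (g \<cdot>\<^bsub>C\<^esub> f)"
  by (simp_all add: quotient_cat_def)

context category
begin

context
  fixes R :: "'a rel"
  assumes R: "congruence C R"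
begin

lemma class_rep_related: "f \<in> Arr C \<Longrightarrow> (f, class_rep R f) \<in> R"
  unfolding class_rep_def using R
  by (intro someI[of "\<lambda>g. (f, g) \<in> R" f]) (auto simp: congruence_def equiv_def refl_on_def)

lemma class_rep_parallel: "f \<in> Arr C \<Longrightarrow> parallel C f (class_rep R f)"
  using class_rep_related R by (auto simp: congruence_def)

lemma class_rep_simps:
  "f \<in> Arr C \<Longrightarrow> class_rep R f \<in> Arr C"
  "f \<in> Arr C \<Longrightarrow> Dom C (class_rep R f) = Dom C f"
  "f \<in> Arr C \<Longrightarrow> Cod C (class_rep R f) = Cod C f"
  using class_rep_parallel by (auto simp: parallel_def)

lemma class_rep_eq_iff:
  assumes "f \<in> Arr C" "g \<in> Arr C"
  shows "class_rep R f = class_rep R g \<longleftrightarrow> (f, g) \<in> R"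
proof
  have sym: "sym R" and trans: "trans R" using R by (auto simp: congruence_def equiv_def)
  show "(f, g) \<in> R" if "class_rep R f = class_rep R g"
    using class_rep_related[of f] class_rep_related[of g] assms that sym trans
    by (metis symD transD)
  assume "(f, g) \<in> R"
  then have "(f, h) \<in> R \<longleftrightarrow> (g, h) \<in> R" for h using sym trans by (meson symD transD)
  then show "class_rep R f = class_rep R g" by (simp add: class_rep_def)
qed

lemma class_rep_cmp:
  assumes f: "f \<in> Arr C" and g: "g \<in> Arr C" and fg: "Cod C f = Dom C g"
  shows "class_rep R (class_rep R g \<cdot> f) = class_rep R (g \<cdot> f)"
    and "class_rep R (g \<cdot> class_rep R f) = class_rep R (g \<cdot> f)"
proof -
  note s = class_rep_simps[OF f] class_rep_simps[OF g]
  \<comment> \<open>A congruence is compatible with composition on both sides at once; padding with an identity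
    gives compatibility on one side.\<close>
  have whisker: "(v \<cdot> h \<cdot> u, v \<cdot> k \<cdot> u) \<in> R"
    if "(h, k) \<in> R" "u \<in> Arr C" "v \<in> Arr C" "Cod C u = Dom C h" "Cod C h = Dom C v" for h k u v
    using R that by (auto simp: congruence_def)
  have "(Idt C (Cod C g) \<cdot> g \<cdot> f, Idt C (Cod C g) \<cdot> class_rep R g \<cdot> f) \<in> R"
    using whisker[OF class_rep_related[OF g] f, of "Idt C (Cod C g)"] g fg
    by (simp add: idt_arr dom_idt cod_obj)
  then have "(g \<cdot> f, class_rep R g \<cdot> f) \<in> R"
    using f g fg s idt_cmp[of "g \<cdot> f"] idt_cmp[of "class_rep R g \<cdot> f"]
    by (simp add: cmp_arr cod_cmp)
  then show "class_rep R (class_rep R g \<cdot> f) = class_rep R (g \<cdot> f)"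
    using f g fg s by (subst class_rep_eq_iff[THEN iffD2, of "g \<cdot> f"]) (auto simp: cmp_arr)
  have "(g \<cdot> f \<cdot> Idt C (Dom C f), g \<cdot> class_rep R f \<cdot> Idt C (Dom C f)) \<in> R"
    using whisker[OF class_rep_related[OF f] _ g, of "Idt C (Dom C f)"] f fg
    by (simp add: idt_arr cod_idt dom_obj)
  then have "(g \<cdot> f, g \<cdot> class_rep R f) \<in> R"
    using f s cmp_idt[of f] cmp_idt[of "class_rep R f"] by simp
  then show "class_rep R (g \<cdot> class_rep R f) = class_rep R (g \<cdot> f)"
    using f g fg s by (subst class_rep_eq_iff[THEN iffD2, of "g \<cdot> f"]) (auto simp: cmp_arr)
qed

lemma category_quotient_cat: "category (quotient_cat C R)"
proof (unfold_locales, unfold quotient_cat_simps)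
  fix f g h
  assume "f \<in> class_rep R ` Arr C" "g \<in> class_rep R ` Arr C" "h \<in> class_rep R ` Arr C"
    and fg: "Cod C f = Dom C g" and gh: "Cod C g = Dom C h"
  then have arr: "f \<in> Arr C" "g \<in> Arr C" "h \<in> Arr C" by (auto simp: class_rep_simps)
  show "class_rep R (class_rep R (h \<cdot> g) \<cdot> f) = class_rep R (h \<cdot> class_rep R (g \<cdot> f))"
    using class_rep_cmp(1)[of f "h \<cdot> g"] class_rep_cmp(2)[of "g \<cdot> f" h] arr fg gh
    by (simp add: cmp_arr dom_cmp cod_cmp cmp_assoc)
next
  fix f assume "f \<in> class_rep R ` Arr C"
  then obtain f0 where f: "f = class_rep R f0" "f0 \<in> Arr C" by auto
  then have arr: "f \<in> Arr C" by (simp add: class_rep_simps)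
  have rep: "class_rep R f = f"
    using f arr class_rep_related[of f0] class_rep_eq_iff[of f0 f] by simp
  show "class_rep R (f \<cdot> class_rep R (Idt C (Dom C f))) = f"
    using class_rep_cmp(2)[of "Idt C (Dom C f)" f] arr rep
    by (simp add: idt_arr cod_idt dom_obj cmp_idt)
  show "class_rep R (class_rep R (Idt C (Cod C f)) \<cdot> f) = f"
    using class_rep_cmp(1)[of f "Idt C (Cod C f)"] arr rep
    by (simp add: idt_arr dom_idt cod_obj idt_cmp)
qed (auto simp: class_rep_simps dom_obj cod_obj idt_arr dom_idt cod_idt cmp_arr dom_cmp cod_cmp)

lemma functor_class_rep: "is_functor C (quotient_cat C R) (\<lambda>A. A) (class_rep R)"
  using class_rep_cmp
  by (auto simp: is_functor_def quotient_cat_simps class_rep_simps)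

lemma inverse_arrows_quotient_cat:
  assumes "f \<in> Arr C" "g \<in> Arr C" "Dom C g = Cod C f" "Cod C g = Dom C f"
    and "(g \<cdot> f, Idt C (Dom C f)) \<in> R" "(f \<cdot> g, Idt C (Cod C f)) \<in> R"
  shows "inverse_arrows (quotient_cat C R) (class_rep R f) (class_rep R g)"
proof -
  have "class_rep R (g \<cdot> f) = class_rep R (Idt C (Dom C f))"
    "class_rep R (f \<cdot> g) = class_rep R (Idt C (Cod C f))"
    using assms by (simp_all add: class_rep_eq_iff cmp_arr idt_arr dom_obj cod_obj)
  then show ?thesis
    using assms class_rep_cmp(1)[of "class_rep R f" g] class_rep_cmp(2)[of f g]
      class_rep_cmp(1)[of "class_rep R g" f] class_rep_cmp(2)[of g f]
    by (simp add: inverse_arrows_def quotient_cat_simps class_rep_simps)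
qed

end

end


section \<open>Inverting the split weak equivalences\<close>

context category_with_weak_equivalences
begin

text \<open>The idempotent of a retract becomes the identity after composing with \<open>r\<close>, and likewise after
  precomposing with \<open>s\<close>: both equations are instances of \<open>r \<cdot> s = 1\<close>.\<close>

lemma retract_idempotent_R:
  assumes r: "r \<in> W" and s: "s \<in> W" and rs: "Cod C s = Dom C r" "Cod C r = Dom C s"
    and eq: "r \<cdot> s = Idt C (Dom C s)"
  shows "(s \<cdot> r, Idt C (Dom C r)) \<in> R_left C W \<inter> R_right C W"
proof -
  have arr: "r \<in> Arr C" "s \<in> Arr C" using r s weq_arr by auto
  have par: "parallel C (s \<cdot> r) (Idt C (Dom C r))"
    using arr rs by (simp add: parallel_def cmp_arr dom_cmp cod_cmp idt_arr dom_idt cod_idt dom_obj)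
  have "r \<cdot> (s \<cdot> r) = r \<cdot> Idt C (Dom C r)"
    using arr rs eq cmp_assoc[of r s r] idt_cmp[of r] cmp_idt[of r] by simp
  moreover have "(s \<cdot> r) \<cdot> s = Idt C (Dom C r) \<cdot> s"
    using arr rs eq cmp_assoc[of s r s] cmp_idt[of s] idt_cmp[of s] by simp
  ultimately show ?thesis
    using par arr rs r s by (auto simp: R_left_def R_right_def cod_cmp dom_cmp)
qed

lemma quotient_inverts_retract:
  assumes R: "congruence C R" "R_left C W \<inter> R_right C W \<subseteq> R"
    and r: "r \<in> W" and s: "s \<in> W" and rs: "Cod C s = Dom C r" "Cod C r = Dom C s"
    and eq: "r \<cdot> s = Idt C (Dom C s)"
  shows "is_iso (quotient_cat C R) (class_rep R r)" "is_iso (quotient_cat C R) (class_rep R s)"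
proof -
  have arr: "r \<in> Arr C" "s \<in> Arr C" using r s weq_arr by auto
  have sr: "(s \<cdot> r, Idt C (Dom C r)) \<in> R"
    using retract_idempotent_R[OF r s rs eq] R(2) by auto
  have rs': "(r \<cdot> s, Idt C (Dom C s)) \<in> R"
    using R(1) eq arr idt_arr[OF dom_obj[of s]] by (auto simp: congruence_def equiv_def refl_on_def)
  show "is_iso (quotient_cat C R) (class_rep R r)" "is_iso (quotient_cat C R) (class_rep R s)"
    using inverse_arrows_quotient_cat[OF R(1), of r s]
      inverse_arrows_quotient_cat[OF R(1), of s r] arr rs sr rs'
    unfolding is_iso_def by auto
qed

text \<open>Two out of three, applied to an identity, makes a one-sided inverse of a weak equivalence a
  weak equivalence.\<close>

lemma quotient_inverts_split:
  assumes R: "congruence C R" "R_left C W \<inter> R_right C W \<subseteq> R"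
    and w: "w \<in> W" and split: "splits C w"
  shows "is_iso (quotient_cat C R) (class_rep R w)"
proof -
  have arr: "w \<in> Arr C" using w weq_arr by auto
  from split consider
      r where "r \<in> Arr C" "Dom C r = Cod C w" "Cod C r = Dom C w" "r \<cdot> w = Idt C (Dom C w)"
    | s where "s \<in> Arr C" "Dom C s = Cod C w" "Cod C s = Dom C w" "w \<cdot> s = Idt C (Cod C w)"
    by (auto simp: splits_def is_section_def is_retraction_def)
  then show ?thesis
  proof cases
    case 1
    then have "r \<in> W" using weq_cancel_right[of w r] w arr weq_idt dom_obj by simp
    then show ?thesis using quotient_inverts_retract(2)[OF R, of r w] 1 w by simp
  next
    case 2
    then have "s \<in> W" using weq_cancel_left[of s w] w arr weq_idt cod_obj by simp
    then show ?thesis using quotient_inverts_retract(1)[OF R, of w s] 2 w by simp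
  qed
qed

end

context split_generated
begin

lemma quotient_inverts:
  assumes R: "congruence C R" "R_left C W \<inter> R_right C W \<subseteq> R"
  shows "inverts W (quotient_cat C R) (class_rep R)"
proof -
  interpret Q: category "quotient_cat C R" by (rule category_quotient_cat[OF R(1)])
  have "w \<in> Arr C \<and> is_iso (quotient_cat C R) (class_rep R w)"
    if "w \<in> split_composites C W" for w
    using that
  proof induction
    case (single w)
    then show ?case using quotient_inverts_split[OF R] weq_arr by auto
  next
    case (comp v w)
    then have arr: "v \<in> Arr C" "w \<in> Arr C" using weq_arr by auto
    have "is_iso (quotient_cat C R) (class_rep R w \<cdot>\<^bsub>quotient_cat C R\<^esub> class_rep R v)"
      using comp arr quotient_inverts_split[OF R] class_rep_simps[OF R(1)]
      by (intro Q.is_iso_cmp) (auto simp: quotient_cat_simps)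
    moreover have "class_rep R w \<cdot>\<^bsub>quotient_cat C R\<^esub> class_rep R v = class_rep R (w \<cdot> v)"
      using functor_class_rep[OF R(1)] arr comp by (simp add: is_functor_def)
    ultimately show ?case using arr comp by (simp add: cmp_arr)
  qed
  then show ?thesis using weq_split by (auto simp: inverts_def)
qed

text \<open>The quotient functor factors through the localization, so it identifies whatever the
  localization identifies.\<close>

lemma homotopy_relation_subset:
  assumes R: "congruence C R" "R_left C W \<inter> R_right C W \<subseteq> R"
  shows "homotopy_relation C (Ho_arr C W) \<subseteq> R"
proof clarify
  fix f g assume "(f, g) \<in> homotopy_relation C (Ho_arr C W)"
  then have fg: "f \<in> Arr C" "g \<in> Arr C" "Ho_arr C W f = Ho_arr C W g"
    by (auto simp: homotopy_relation_def parallel_def)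
  obtain Ga where "\<forall>h\<in>Arr C. Ga (Ho_arr C W h) = class_rep R h"
    using Ho_factorization[OF category_quotient_cat[OF R(1)] functor_class_rep[OF R(1)]
        quotient_inverts[OF R]] by blast
  then have "class_rep R f = class_rep R g" using fg by metis
  then show "(f, g) \<in> R" using class_rep_eq_iff[OF R(1)] fg by simp
qed

text \<open>Stated for any generating relation between \<open>R_left \<inter> R_right\<close> and \<open>R_left \<union> R_right\<close>, so that
  the left and the right congruence are two instances.\<close>

lemma congruence_closure_eq_homotopy_relation:
  assumes lower: "R_left C W \<inter> R_right C W \<subseteq> S" and upper: "S \<subseteq> R_left C W \<union> R_right C W"
  shows "congruence_closure C S = homotopy_relation C (Ho_arr C W)"
proof
  have "S \<subseteq> homotopy_relation C (Ho_arr C W)"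
    using upper R_left_subset_kernel[OF category_Ho functor_Ho inverts_Ho]
      R_right_subset_kernel[OF category_Ho functor_Ho inverts_Ho] by blast
  then show "congruence_closure C S \<subseteq> homotopy_relation C (Ho_arr C W)"
    by (rule congruence_closure_least[OF congruence_functor_kernel[OF functor_Ho]])
  have par: "parallel C f g" if "(f, g) \<in> S" for f g
    using that upper by (auto simp: R_left_def R_right_def)
  show "homotopy_relation C (Ho_arr C W) \<subseteq> congruence_closure C S"
    using homotopy_relation_subset[OF congruence_congruence_closure(1)[OF par]]
      congruence_congruence_closure(2)[OF par] lower by blast
qed

end


section \<open>Coincidence of the congruences\<close>

theorem proposition3p2p2:
  fixes C :: "('o, 'a) cat" and W :: "'a set"
    and H :: "('p, 'b) cat" and \<gamma>o :: "'o \<Rightarrow> 'p" and \<gamma>a :: "'a \<Rightarrow> 'b"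
  assumes "split_generated C W"
    and "is_localization TYPE(('o, ('o, 'a) zigzag_class) cat) C W H \<gamma>o \<gamma>a"
  shows "left_congruence C W = right_congruence C W \<and>
    right_congruence C W = homotopy_relation C \<gamma>a"
proof -
  interpret split_generated C W by (rule assms(1))
  have "left_congruence C W = homotopy_relation C (Ho_arr C W)"
    "right_congruence C W = homotopy_relation C (Ho_arr C W)"
    unfolding left_congruence_def right_congruence_def
    by (auto intro!: congruence_closure_eq_homotopy_relation)
  then show ?thesis using homotopy_relation_unique[OF assms(2)] by simp
qed

end
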